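(* The logic $\mathsf{WPLC}$ is sound and complete relative to the class $\mathbf{QMDM}$: a formula of $\mathcal{L}$ is a theorem of $\mathsf{WPLC}$ if and only if it is valid in every quasi-multi-decision model.
   Context: Let $\mathit{Atm}_0$ be a countable (finite or infinite) set of atomic propositions and $\mathit{Val}$ a finite set of output values; decision atoms $\mathsf{t}(x)$ for $x\in\mathit{Val}$, $\mathit{Dec}=\{\mathsf{t}(x):x\in\mathit{Val}\}$, $\mathit{Atm}=\mathit{Atm}_0\cup\mathit{Dec}$. Language $\mathcal{L}$: $\varphi ::= p \mid \mathsf{t}(x)\mid \neg\varphi\mid \varphi\wedge\varphi\mid \Box_{\mathtt{I}}\varphi\mid \Box_{\mathtt{F}}\varphi$ ($p\in\mathit{Atm}_0$, $x\in\mathit{Val}$). The logic $\mathsf{WPLC}$ is the extension of classical propositional logic by the following axioms and rules, $\blacksquare$ ranging over $\{\Box_{\mathtt{I}},\Box_{\mathtt{F}}\}$: K: $(\blacksquare\varphi\wedge\blacksquare(\varphi\to\psi))\to\blacksquare\psi$; T: $\blacksquare\varphi\to\varphi$; 4: $\blacksquare\varphi\to\blacksquare\blacksquare\varphi$; 5: $\neg\blacksquare\varphi\to\blacksquare\neg\blacksquare\varphi$; Comm: $\Box_{\mathtt{F}}\Box_{\mathtt{I}}\varphi\leftrightarrow\Box_{\mathtt{I}}\Box_{\mathtt{F}}\varphi$; AtLeast: $\bigvee_{x\in\mathit{Val}}\mathsf{t}(x)$; AtMost: $\mathsf{t}(x)\to\neg\mathsf{t}(y)$ for $x\neq y$; Indep: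 $p\to\Box_{\mathtt{F}}p$ and $\neg p\to\Box_{\mathtt{F}}\neg p$ for $p\in\mathit{Atm}_0$; Nec: from $\varphi$ infer $\blacksquare\varphi$. A quasi-multi-decision model (quasi-MDM) is a tuple $M=(W,\sim_{\Box_{\mathtt{I}}},\sim_{\Box_{\mathtt{F}}},V)$ with $W$ a set, $\sim_{\Box_{\mathtt{I}}},\sim_{\Box_{\mathtt{F}}}$ equivalence relations on $W$, $V:W\to2^{\mathit{Atm}}$, writing $V_Y(w)=V(w)\cap Y$, such that for all $w,v\in W$, $x,y\in\mathit{Val}$: (C1) $\sim_{\Box_{\mathtt{I}}}\circ\sim_{\Box_{\mathtt{F}}}=\sim_{\Box_{\mathtt{F}}}\circ\sim_{\Box_{\mathtt{I}}}$; (C3) if $w\sim_{\Box_{\mathtt{F}}}v$ then $V_{\mathit{Atm}_0}(w)=V_{\mathit{Atm}_0}(v)$; (C4) if $\mathsf{t}(x)\in V(w)$ and $x\neq y$ then $\mathsf{t}(y)\notin V(w)$; (C5) some $\mathsf{t}(x)\in V(w)$. Truth: atoms $q\in\mathit{Atm}$ true at $w$ iff $q\in V(w)$; Boolean connectives as usual; $\Box_{\mathtt{I}}\varphi$ (resp. $\Box_{\mathtt{F}}\varphi$) true at $w$ iff $\varphi$ true at all $\sim_{\Box_{\mathtt{I}}}$- (resp. $\sim_{\Box_{\mathtt{F}}}$-) related worlds. *)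

theory Defs
  imports Main "HOL-Library.Countable_Set"
begin

datatype ('p, 'v) atom = Prp 'p | Dec 'v

datatype modality = I | F

datatype (atoms: 'a) fm =
    Atom 'a
  | Neg "'a fm"
  | And "'a fm" "'a fm"
  | Box modality "'a fm"

abbreviation Or :: "'a fm \<Rightarrow> 'a fm \<Rightarrow> 'a fm" where
  "Or \<phi> \<psi> \<equiv> Neg (And (Neg \<phi>) (Neg \<psi>))"

abbreviation Imp :: "'a fm \<Rightarrow> 'a fm \<Rightarrow> 'a fm" where
  "Imp \<phi> \<psi> \<equiv> Neg (And \<phi> (Neg \<psi>))"

abbreviation Iff :: "'a fm \<Rightarrow> 'a fm \<Rightarrow> 'a fm" where
  "Iff \<phi> \<psi> \<equiv> And (Imp \<phi> \<psi>) (Imp \<psi> \<phi>)"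

text \<open>The language has no primitive falsum, so the value of the empty disjunction
  is a parameter; it is irrelevant for nonempty lists.\<close>

fun Disj :: "'a fm \<Rightarrow> 'a fm list \<Rightarrow> 'a fm" where
  "Disj \<beta> [] = \<beta>"
| "Disj \<beta> [\<phi>] = \<phi>"
| "Disj \<beta> (\<phi> # \<psi> # \<phi>s) = Or \<phi> (Disj \<beta> (\<psi> # \<phi>s))"

definition Atm :: "'p set \<Rightarrow> 'v set \<Rightarrow> ('p, 'v) atom set" where
  "Atm Atm0 Val = Prp ` Atm0 \<union> Dec ` Val"

definition language :: "'p set \<Rightarrow> 'v set \<Rightarrow> ('p, 'v) atom fm set" where
  "language Atm0 Val = {\<phi>. atoms \<phi> \<subseteq> Atm Atm0 Val}"

text \<open>Instances of classical tautologies are the formulas that hold under every Boolean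
  valuation in which atoms and boxed formulas are both treated as propositional variables.\<close>

primrec bool_eval :: "('a fm \<Rightarrow> bool) \<Rightarrow> 'a fm \<Rightarrow> bool" where
  "bool_eval g (Atom q) \<longleftrightarrow> g (Atom q)"
| "bool_eval g (Neg \<phi>) \<longleftrightarrow> \<not> bool_eval g \<phi>"
| "bool_eval g (And \<phi> \<psi>) \<longleftrightarrow> bool_eval g \<phi> \<and> bool_eval g \<psi>"
| "bool_eval g (Box m \<phi>) \<longleftrightarrow> g (Box m \<phi>)"

definition tautology :: "'a fm \<Rightarrow> bool" where
  "tautology \<phi> \<longleftrightarrow> (\<forall>g. bool_eval g \<phi>)"

text \<open>In \<open>AtLeast\<close>, \<open>xs\<close> is any enumeration of \<open>Val\<close> without repetitions; for empty
  \<open>Val\<close> the axiom is a contradiction.\<close>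

inductive WPLC :: "'p set \<Rightarrow> 'v set \<Rightarrow> ('p, 'v) atom fm \<Rightarrow> bool"
  for Atm0 :: "'p set" and Val :: "'v set"
where
  Taut: "\<phi> \<in> language Atm0 Val \<Longrightarrow> tautology \<phi> \<Longrightarrow> WPLC Atm0 Val \<phi>"
| K: "\<phi> \<in> language Atm0 Val \<Longrightarrow> \<psi> \<in> language Atm0 Val \<Longrightarrow>
    WPLC Atm0 Val (Imp (And (Box m \<phi>) (Box m (Imp \<phi> \<psi>))) (Box m \<psi>))"
| T: "\<phi> \<in> language Atm0 Val \<Longrightarrow> WPLC Atm0 Val (Imp (Box m \<phi>) \<phi>)"
| Four: "\<phi> \<in> language Atm0 Val \<Longrightarrow> WPLC Atm0 Val (Imp (Box m \<phi>) (Box m (Box m \<phi>)))"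
| Five: "\<phi> \<in> language Atm0 Val \<Longrightarrow>
    WPLC Atm0 Val (Imp (Neg (Box m \<phi>)) (Box m (Neg (Box m \<phi>))))"
| Comm: "\<phi> \<in> language Atm0 Val \<Longrightarrow>
    WPLC Atm0 Val (Iff (Box F (Box I \<phi>)) (Box I (Box F \<phi>)))"
| AtLeast: "distinct xs \<Longrightarrow> set xs = Val \<Longrightarrow> \<chi> \<in> language Atm0 Val \<Longrightarrow>
    WPLC Atm0 Val (Disj (And \<chi> (Neg \<chi>)) (map (\<lambda>x. Atom (Dec x)) xs))"
| AtMost: "x \<in> Val \<Longrightarrow> y \<in> Val \<Longrightarrow> x \<noteq> y \<Longrightarrow>
    WPLC Atm0 Val (Imp (Atom (Dec x)) (Neg (Atom (Dec y))))"
| Indep_pos: "p \<in> Atm0 \<Longrightarrow> WPLC Atm0 Val (Imp (Atom (Prp p)) (Box F (Atom (Prp p))))"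
| Indep_neg: "p \<in> Atm0 \<Longrightarrow>
    WPLC Atm0 Val (Imp (Neg (Atom (Prp p))) (Box F (Neg (Atom (Prp p)))))"
| MP: "WPLC Atm0 Val \<phi> \<Longrightarrow> WPLC Atm0 Val (Imp \<phi> \<psi>) \<Longrightarrow> WPLC Atm0 Val \<psi>"
| Nec: "WPLC Atm0 Val \<phi> \<Longrightarrow> WPLC Atm0 Val (Box m \<phi>)"

record ('w, 'p, 'v) model =
  worlds :: "'w set"
  rel :: "modality \<Rightarrow> ('w \<times> 'w) set"
  val :: "'w \<Rightarrow> ('p, 'v) atom set"

definition quasi_MDM :: "'p set \<Rightarrow> 'v set \<Rightarrow> ('w, 'p, 'v) model \<Rightarrow> bool" where
  "quasi_MDM Atm0 Val M \<longleftrightarrow>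
     (\<forall>m. equiv (worlds M) (rel M m)) \<and>
     (\<forall>w \<in> worlds M. val M w \<subseteq> Atm Atm0 Val) \<and>
     rel M I O rel M F = rel M F O rel M I \<and>
     (\<forall>w \<in> worlds M. \<forall>v \<in> worlds M. (w, v) \<in> rel M F \<longrightarrow>
        val M w \<inter> Prp ` Atm0 = val M v \<inter> Prp ` Atm0) \<and>
     (\<forall>w \<in> worlds M. \<forall>x \<in> Val. \<forall>y \<in> Val.
        Dec x \<in> val M w \<and> x \<noteq> y \<longrightarrow> Dec y \<notin> val M w) \<and>
     (\<forall>w \<in> worlds M. \<exists>x \<in> Val. Dec x \<in> val M w)"

primrec sat :: "('w, 'p, 'v) model \<Rightarrow> 'w \<Rightarrow> ('p, 'v) atom fm \<Rightarrow> bool" where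
  "sat M w (Atom q) \<longleftrightarrow> q \<in> val M w"
| "sat M w (Neg \<phi>) \<longleftrightarrow> \<not> sat M w \<phi>"
| "sat M w (And \<phi> \<psi>) \<longleftrightarrow> sat M w \<phi> \<and> sat M w \<psi>"
| "sat M w (Box m \<phi>) \<longleftrightarrow> (\<forall>v \<in> worlds M. (w, v) \<in> rel M m \<longrightarrow> sat M v \<phi>)"

text \<open>HOL cannot quantify over types inside a formula, so the type of worlds is an
  explicit parameter of validity. Soundness is to be claimed for every type of worlds;
  completeness needs one sufficiently large type, such as that of sets of formulas.\<close>

definition QMDM_valid ::
    "'w itself \<Rightarrow> 'p set \<Rightarrow> 'v set \<Rightarrow> ('p, 'v) atom fm \<Rightarrow> bool" where
  "QMDM_valid _ Atm0 Val \<phi> \<longleftrightarrow>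
     (\<forall>M :: ('w, 'p, 'v) model. quasi_MDM Atm0 Val M \<longrightarrow> (\<forall>w \<in> worlds M. sat M w \<phi>))"

end

theory Submission
  imports Defs
begin

text \<open>Completeness is shown on the canonical model. The point specific to this logic is that
  the two canonical relations commute: if \<open>w \<sim>\<^sub>I u \<sim>\<^sub>F v\<close>, the formulas boxed by \<open>F\<close> in \<open>w\<close>
  together with those boxed by \<open>I\<close> in \<open>v\<close> are consistent. Otherwise \<open>w\<close> contains
  \<open>\<box>\<^sub>F \<not>\<box>\<^sub>I \<psi>\<close> for some \<open>\<box>\<^sub>I \<psi> \<in> v\<close>, hence \<open>\<box>\<^sub>F \<box>\<^sub>I \<not>\<box>\<^sub>I \<psi>\<close> by axiom 5 and \<open>\<box>\<^sub>I \<box>\<^sub>F \<not>\<box>\<^sub>I \<psi>\<close> by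
  commutation, which forces \<open>\<not>\<box>\<^sub>I \<psi> \<in> v\<close>.\<close>

section \<open>Formulas of the language\<close>

lemma language_simps [simp]:
  "Neg \<phi> \<in> language A V \<longleftrightarrow> \<phi> \<in> language A V"
  "And \<phi> \<psi> \<in> language A V \<longleftrightarrow> \<phi> \<in> language A V \<and> \<psi> \<in> language A V"
  "Box m \<phi> \<in> language A V \<longleftrightarrow> \<phi> \<in> language A V"
  "Atom q \<in> language A V \<longleftrightarrow> q \<in> Atm A V"
  by (auto simp: language_def)

lemma Atm_simps [simp]:
  "Prp p \<in> Atm A V \<longleftrightarrow> p \<in> A"
  "Dec x \<in> Atm A V \<longleftrightarrow> x \<in> V"
  by (auto simp: Atm_def)

lemma Disj_language:
  "\<beta> \<in> language A V \<Longrightarrow> set \<phi>s \<subseteq> language A V \<Longrightarrow> Disj \<beta> \<phi>s \<in> language A V"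
  by (induction \<beta> \<phi>s rule: Disj.induct) auto

lemma WPLC_language: "WPLC A V \<phi> \<Longrightarrow> \<phi> \<in> language A V"
  by (induction rule: WPLC.induct) (auto intro!: Disj_language)

subsection \<open>Soundness\<close>

text \<open>Truth at a fixed world is itself a Boolean valuation that treats boxed formulas as
  variables, so every tautology holds at every world.\<close>

lemma sat_eq_bool_eval: "sat M w \<phi> \<longleftrightarrow> bool_eval (sat M w) \<phi>"
  by (induction \<phi>) auto

lemma sat_Disj: "\<phi> \<in> set \<phi>s \<Longrightarrow> sat M w \<phi> \<Longrightarrow> sat M w (Disj \<beta> \<phi>s)"
  by (induction \<beta> \<phi>s rule: Disj.induct) auto

lemma WPLC_sound:
  assumes "WPLC A V \<phi>" and M: "quasi_MDM A V M" and "w \<in> worlds M"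
  shows "sat M w \<phi>"
proof -
  have eq: "equiv (worlds M) (rel M m)" for m
    using M by (simp add: quasi_MDM_def)
  have sub: "\<And>m a b. (a, b) \<in> rel M m \<Longrightarrow> a \<in> worlds M \<and> b \<in> worlds M"
    using eq by (meson equiv_class_eq_iff)
  have refl: "\<And>m a. a \<in> worlds M \<Longrightarrow> (a, a) \<in> rel M m"
    using eq by (meson equiv_def refl_onD)
  \<comment> \<open>Related worlds see the same worlds; this settles axioms 4 and 5.\<close>
  have eucl: "\<And>m a b c. (a, b) \<in> rel M m \<Longrightarrow> (a, c) \<in> rel M m \<longleftrightarrow> (b, c) \<in> rel M m"
    using eq by (meson equiv_def symE transE)
  have comm: "rel M I O rel M F = rel M F O rel M I"
    using M by (simp add: quasi_MDM_def)
  have "\<forall>w\<in>worlds M. \<forall>v\<in>worlds M. (w, v) \<in> rel M F \<longrightarrow>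
      val M w \<inter> Prp ` A = val M v \<inter> Prp ` A"
    using M unfolding quasi_MDM_def by (elim conjE)
  then have C3: "Prp p \<in> val M a \<longleftrightarrow> Prp p \<in> val M b" if "(a, b) \<in> rel M F" "p \<in> A" for a b p
    using sub[OF that(1)] that by blast
  have C4: "\<forall>w\<in>worlds M. \<forall>x\<in>V. \<forall>y\<in>V. Dec x \<in> val M w \<and> x \<noteq> y \<longrightarrow> Dec y \<notin> val M w"
    using M unfolding quasi_MDM_def by (elim conjE)
  have C5: "\<forall>w\<in>worlds M. \<exists>x\<in>V. Dec x \<in> val M w"
    using M unfolding quasi_MDM_def by (elim conjE)
  show ?thesis
    using assms(1,3)
  proof (induction arbitrary: w rule: WPLC.induct)
    case (Taut \<phi>)
    then show ?case by (subst sat_eq_bool_eval) (simp add: tautology_def)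
  next
    case (T \<phi> m)
    then show ?case using refl by auto
  next
    case (Four \<phi> m)
    then show ?case using refl by (auto simp: eucl)
  next
    case (Five \<phi> m)
    then show ?case by simp (metis eucl)
  next
    case (Comm \<phi>)
    \<comment> \<open>Two nested boxes act as one box over the composed relation, which turns
      \<open>Comm\<close> into the equality (C1) of the two compositions.\<close>
    have box2: "sat M w (Box m (Box m' \<phi>)) \<longleftrightarrow> (\<forall>c. (w, c) \<in> rel M m O rel M m' \<longrightarrow> sat M c \<phi>)"
      for m m' using sub by (auto simp: relcomp_unfold)
    have "sat M w (Box F (Box I \<phi>)) \<longleftrightarrow> sat M w (Box I (Box F \<phi>))"
      unfolding box2 comm ..
    then show ?case unfolding sat.simps(2,3) by blast
  next
    case (AtLeast xs \<chi>)
    then obtain x where "x \<in> set xs" "Dec x \<in> val M w"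
      using C5 by blast
    then show ?case
      by (intro sat_Disj[of "Atom (Dec x)"]) auto
  next
    case (AtMost x y)
    then have "Dec y \<notin> val M w" if "Dec x \<in> val M w" using C4 that by blast
    then show ?case by simp
  next
    case (Indep_pos p)
    then show ?case using C3 by auto
  next
    case (Indep_neg p)
    then show ?case using C3 by auto
  qed auto
qed

corollary WPLC_valid: "WPLC A V \<phi> \<Longrightarrow> QMDM_valid X A V \<phi>"
  by (simp add: QMDM_valid_def WPLC_sound)

subsection \<open>Derivability from assumptions\<close>

context
  fixes Atm0 :: "'p set" and Val :: "'v set"
begin

abbreviation L :: "('p, 'v) atom fm set" where
  "L \<equiv> language Atm0 Val"

text \<open>Necessitation is not a rule here and is applied only to theorems, via
  \<open>axm\<close>; this is what lets the deduction theorem go through. The restriction of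
  \<open>hyp\<close> to \<open>L\<close> keeps all derivable formulas in the language, whatever
  \<open>S\<close> is.\<close>

inductive derives :: "('p, 'v) atom fm set \<Rightarrow> ('p, 'v) atom fm \<Rightarrow> bool" for S where
  hyp: "\<phi> \<in> S \<Longrightarrow> \<phi> \<in> L \<Longrightarrow> derives S \<phi>"
| axm: "WPLC Atm0 Val \<phi> \<Longrightarrow> derives S \<phi>"
| mp: "derives S \<phi> \<Longrightarrow> derives S (Imp \<phi> \<psi>) \<Longrightarrow> derives S \<psi>"

lemma derives_language: "derives S \<phi> \<Longrightarrow> \<phi> \<in> L"
  by (induction rule: derives.induct) (auto dest: WPLC_language)

lemma derives_empty: "derives {} \<phi> \<Longrightarrow> WPLC Atm0 Val \<phi>"
  by (induction rule: derives.induct) (auto intro: WPLC.MP)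

lemma derives_taut: "tautology \<phi> \<Longrightarrow> \<phi> \<in> L \<Longrightarrow> derives S \<phi>"
  by (intro axm Taut)

text \<open>Together with \<open>derives_taut2\<close> this reduces propositional reasoning to
  checks of \<open>tautology\<close>, in place of explicit Hilbert-style derivations.\<close>

lemma derives_taut1:
  "derives S \<phi> \<Longrightarrow> tautology (Imp \<phi> \<psi>) \<Longrightarrow> \<psi> \<in> L \<Longrightarrow> derives S \<psi>"
  by (meson derives_language derives_taut language_simps(1,2) mp)

lemma derives_taut2:
  assumes "derives S \<phi>" "derives S \<psi>" "tautology (Imp \<phi> (Imp \<psi> \<chi>))" "\<chi> \<in> L"
  shows "derives S \<chi>"
  using assms by (meson derives_language derives_taut1 language_simps(1,2) mp)

lemma derives_mono: "derives S \<phi> \<Longrightarrow> S \<subseteq> S' \<Longrightarrow> derives S' \<phi>"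
  by (induction rule: derives.induct) (auto intro: derives.intros)

lemma deduction:
  "derives (insert \<psi> S) \<phi> \<Longrightarrow> \<psi> \<in> L \<Longrightarrow> derives S (Imp \<psi> \<phi>)"
proof (induction rule: derives.induct)
  case (hyp \<phi>)
  show ?case
  proof (cases "\<phi> = \<psi>")
    case True
    then show ?thesis using hyp by (intro derives_taut) (auto simp: tautology_def)
  next
    case False
    then have "derives S \<phi>" using hyp by (auto intro: derives.hyp)
    then show ?thesis using hyp by (rule_tac derives_taut1) (auto simp: tautology_def)
  qed
next
  case (axm \<phi>)
  then show ?case
    by (rule_tac derives_taut1[OF derives.axm]) (auto simp: tautology_def dest: WPLC_language)
next
  case (mp \<phi> \<chi>)
  then have "derives S (Imp \<psi> \<phi>)" "derives S (Imp \<psi> (Imp \<phi> \<chi>))" by auto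
  then show ?case
    by (rule derives_taut2) (use mp derives_language in \<open>fastforce simp: tautology_def\<close>)+
qed

text \<open>Compactness, needed for unions of chains in the application of Zorn's lemma.\<close>

lemma derives_finite:
  "derives S \<phi> \<Longrightarrow> \<exists>T. finite T \<and> T \<subseteq> S \<and> derives T \<phi>"
proof (induction rule: derives.induct)
  case (hyp \<phi>)
  then show ?case by (intro exI[of _ "{\<phi>}"]) (auto intro: derives.hyp)
next
  case (axm \<phi>)
  then show ?case by (intro exI[of _ "{}"]) (auto intro: derives.axm)
next
  case (mp \<phi> \<psi>)
  then obtain T T' where "finite T" "T \<subseteq> S" "derives T \<phi>"
    "finite T'" "T' \<subseteq> S" "derives T' (Imp \<phi> \<psi>)" by blast
  then show ?case
    by (intro exI[of _ "T \<union> T'"])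
      (auto intro: derives.mp[of _ \<phi>] derives_mono)
qed

subsection \<open>Maximal consistent sets\<close>

text \<open>Maximality is expressed by its working consequences, deductive closure and negation
  completeness. The last clause also prevents \<open>w\<close> from containing a formula together
  with its negation.\<close>

definition mcs :: "('p, 'v) atom fm set \<Rightarrow> bool" where
  "mcs w \<longleftrightarrow> w \<subseteq> L \<and> (\<forall>\<phi>. derives w \<phi> \<longrightarrow> \<phi> \<in> w) \<and>
    (\<forall>\<phi> \<in> L. Neg \<phi> \<in> w \<longleftrightarrow> \<phi> \<notin> w)"

text \<open>In the absence of falsum, consistency is taken relative to \<open>\<phi>\<close>: Zorn's
  lemma yields an extension of \<open>S\<close> that is maximal among those not deriving
  \<open>\<phi>\<close>.\<close>

lemma Lindenbaum:
  assumes "S \<subseteq> L" "\<phi> \<in> L" "\<not> derives S \<phi>"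
  obtains w where "mcs w" "S \<subseteq> w" "\<phi> \<notin> w"
proof -
  define \<A> where "\<A> = {X. S \<subseteq> X \<and> X \<subseteq> L \<and> \<not> derives X \<phi>}"
  have "\<exists>w\<in>\<A>. \<forall>X\<in>\<A>. w \<subseteq> X \<longrightarrow> X = w"
  proof (rule subset_Zorn_nonempty)
    show "\<A> \<noteq> {}" using assms by (auto simp: \<A>_def)
    fix \<C> assume \<C>: "\<C> \<noteq> {}" "subset.chain \<A> \<C>"
    have "\<not> derives (\<Union>\<C>) \<phi>"
    proof
      assume "derives (\<Union>\<C>) \<phi>"
      then obtain T where T: "finite T" "T \<subseteq> \<Union>\<C>" "derives T \<phi>"
        using derives_finite by blast
      then obtain X where "X \<in> \<C>" "T \<subseteq> X"
        using finite_subset_Union_chain[OF _ _ \<C>] by metis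
      then show False
        using T derives_mono \<C>(2) by (auto simp: subset.chain_def \<A>_def)
    qed
    then show "\<Union>\<C> \<in> \<A>"
      using \<C> by (auto simp: \<A>_def subset.chain_def)
  qed
  then obtain w where "w \<in> \<A>" and maximal: "\<And>X. X \<in> \<A> \<Longrightarrow> w \<subseteq> X \<Longrightarrow> X = w"
    by blast
  then have w: "S \<subseteq> w" "w \<subseteq> L" "\<not> derives w \<phi>"
    by (simp_all add: \<A>_def)
  have max: "derives (insert \<psi> w) \<phi>" if "\<psi> \<in> L" "\<psi> \<notin> w" for \<psi>
  proof (rule ccontr)
    assume "\<not> derives (insert \<psi> w) \<phi>"
    then have "insert \<psi> w \<in> \<A>" using w that(1) by (auto simp: \<A>_def)
    then show False using maximal that(2) by blast
  qed
  have closed: "\<psi> \<in> w" if "derives w \<psi>" for \<psi>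
  proof (rule ccontr)
    assume "\<psi> \<notin> w"
    then have "derives w (Imp \<psi> \<phi>)"
      using max deduction derives_language[OF that] by simp
    then show False using mp[OF that] w by simp
  qed
  have neg: "Neg \<psi> \<in> w \<longleftrightarrow> \<psi> \<notin> w" if "\<psi> \<in> L" for \<psi>
  proof
    assume "Neg \<psi> \<in> w"
    then have "\<psi> \<in> w \<Longrightarrow> derives w \<phi>"
      using that assms(2)
      by (intro derives_taut2[OF hyp[of \<psi>] hyp[of "Neg \<psi>"]]) (auto simp: tautology_def)
    then show "\<psi> \<notin> w" using w by blast
  next
    assume *: "\<psi> \<notin> w"
    show "Neg \<psi> \<in> w"
    proof (rule ccontr)
      assume "Neg \<psi> \<notin> w"
      \<comment> \<open>By maximality, adding either \<open>\<psi>\<close> or its negation makes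
        \<open>\<phi>\<close> derivable; a case distinction then derives it from \<open>w\<close>
        alone.\<close>
      then have "derives w (Imp \<psi> \<phi>)" "derives w (Imp (Neg \<psi>) \<phi>)"
        using * max[of \<psi>] max[of "Neg \<psi>"] deduction[of \<psi>] deduction[of "Neg \<psi>"] that
        by simp_all
      then have "derives w \<phi>"
        by (rule derives_taut2) (auto simp: tautology_def assms)
      then show False using w by blast
    qed
  qed
  show ?thesis
  proof (rule that)
    show "mcs w" using w closed neg by (simp add: mcs_def)
    show "\<phi> \<notin> w" using w hyp[of \<phi> w] assms(2) by blast
  qed (rule w)
qed

lemma mcs_language: "mcs w \<Longrightarrow> \<phi> \<in> w \<Longrightarrow> \<phi> \<in> L"
  by (auto simp: mcs_def)

lemma mcs_Neg: "mcs w \<Longrightarrow> \<phi> \<in> L \<Longrightarrow> Neg \<phi> \<in> w \<longleftrightarrow> \<phi> \<notin> w"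
  by (auto simp: mcs_def)

lemma mcs_derives: "mcs w \<Longrightarrow> derives w \<phi> \<Longrightarrow> \<phi> \<in> w"
  by (auto simp: mcs_def)

lemma mcs_WPLC: "mcs w \<Longrightarrow> WPLC Atm0 Val \<phi> \<Longrightarrow> \<phi> \<in> w"
  by (auto intro: mcs_derives axm)

lemma mcs_And:
  assumes "mcs w"
  shows "And \<phi> \<psi> \<in> w \<longleftrightarrow> \<phi> \<in> w \<and> \<psi> \<in> w"
proof
  assume *: "And \<phi> \<psi> \<in> w"
  then have L: "\<phi> \<in> L" "\<psi> \<in> L" using mcs_language[OF assms *] by auto
  have "derives w (And \<phi> \<psi>)" using * L by (auto intro: hyp)
  then have "derives w \<phi>" "derives w \<psi>"
    by (rule derives_taut1; simp add: tautology_def L)+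
  then show "\<phi> \<in> w \<and> \<psi> \<in> w" using assms mcs_derives by blast
next
  assume *: "\<phi> \<in> w \<and> \<psi> \<in> w"
  then have "\<phi> \<in> L" "\<psi> \<in> L" using mcs_language[OF assms] by auto
  then have "derives w (And \<phi> \<psi>)"
    using * by (intro derives_taut2[OF hyp[of \<phi>] hyp[of \<psi>]]) (auto simp: tautology_def)
  then show "And \<phi> \<psi> \<in> w" using assms mcs_derives by blast
qed

lemma mcs_Imp:
  assumes "mcs w" "WPLC Atm0 Val (Imp \<phi> \<psi>)" "\<phi> \<in> w"
  shows "\<psi> \<in> w"
  using assms by (meson hyp mcs_derives mcs_language mp axm)

text \<open>The condition on \<open>\<beta>\<close> handles the empty list, where the disjunction is
  \<open>\<beta>\<close> itself.\<close>

lemma mcs_Disj: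
  "mcs w \<Longrightarrow> Disj \<beta> \<phi>s \<in> w \<Longrightarrow> \<beta> \<notin> w \<Longrightarrow> \<exists>\<phi> \<in> set \<phi>s. \<phi> \<in> w"
proof (induction \<beta> \<phi>s rule: Disj.induct)
  case (3 \<beta> \<phi> \<psi> \<phi>s)
  then have "Or \<phi> (Disj \<beta> (\<psi> # \<phi>s)) \<in> w" by simp
  with mcs_language[OF 3(2) this] have "\<phi> \<in> w \<or> Disj \<beta> (\<psi> # \<phi>s) \<in> w"
    using 3(2) by (simp add: mcs_Neg mcs_And)
  then show ?case using 3 by auto
qed auto

subsection \<open>The canonical model\<close>

lemma mcs_Box_mp:
  assumes "mcs w" "Box m \<phi> \<in> w" "Box m (Imp \<phi> \<psi>) \<in> w"
  shows "Box m \<psi> \<in> w"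
proof -
  have "And (Box m \<phi>) (Box m (Imp \<phi> \<psi>)) \<in> w" using assms by (simp add: mcs_And)
  moreover have "\<phi> \<in> L" "\<psi> \<in> L" using assms mcs_language[of w "Box m (Imp \<phi> \<psi>)"] by auto
  ultimately show ?thesis using assms mcs_Imp K by blast
qed

text \<open>The formulas boxed in \<open>w\<close> are closed under derivation: theorems enter by
  necessitation, and modus ponens is preserved by axiom K.\<close>

lemma mcs_Box_derives:
  assumes "mcs w"
  shows "derives {\<psi>. Box m \<psi> \<in> w} \<phi> \<Longrightarrow> Box m \<phi> \<in> w"
  by (induction rule: derives.induct) (auto intro: mcs_WPLC Nec mcs_Box_mp assms)

definition canon :: "modality \<Rightarrow> (('p, 'v) atom fm set \<times> ('p, 'v) atom fm set) set" where
  "canon m = {(w, v). mcs w \<and> mcs v \<and> (\<forall>\<phi>. Box m \<phi> \<in> w \<longrightarrow> \<phi> \<in> v)}"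

text \<open>Axiom 4 carries boxes forward, axiom 5 carries their absence forward. Sharing all boxed
  formulas is an equivalence, which is how symmetry and transitivity are obtained.\<close>

lemma canon_Box_iff:
  assumes "(w, v) \<in> canon m"
  shows "Box m \<phi> \<in> w \<longleftrightarrow> Box m \<phi> \<in> v"
proof
  assume "Box m \<phi> \<in> w"
  moreover from this have "\<phi> \<in> L"
    using assms mcs_language[of w "Box m \<phi>"] by (auto simp: canon_def)
  ultimately show "Box m \<phi> \<in> v"
    using assms mcs_Imp[OF _ Four] unfolding canon_def by blast
next
  assume *: "Box m \<phi> \<in> v"
  have w: "mcs w" and v: "mcs v" using assms by (auto simp: canon_def)
  have L: "\<phi> \<in> L" using mcs_language[OF v *] by simp
  show "Box m \<phi> \<in> w"
  proof (rule ccontr)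
    assume "Box m \<phi> \<notin> w"
    then have "Box m (Neg (Box m \<phi>)) \<in> w"
      using mcs_Imp[OF w Five] mcs_Neg[OF w] L by simp
    then have "Neg (Box m \<phi>) \<in> v" using assms by (auto simp: canon_def)
    then show False using mcs_Neg[OF v] * L by simp
  qed
qed

lemma canon_refl:
  assumes "mcs w"
  shows "(w, w) \<in> canon m"
proof -
  have "\<phi> \<in> w" if "Box m \<phi> \<in> w" for \<phi>
    using mcs_Imp[OF assms T] mcs_language[OF assms that] that by simp
  then show ?thesis by (simp add: canon_def assms)
qed

text \<open>Axiom T in \<open>v\<close> removes the box, so preservation of boxed formulas is
  enough.\<close>

lemma canonI:
  assumes "mcs w" "mcs v" "\<And>\<phi>. Box m \<phi> \<in> w \<Longrightarrow> Box m \<phi> \<in> v"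
  shows "(w, v) \<in> canon m"
  using assms canon_refl[of v] by (auto simp: canon_def)

lemma canon_mcs: "(w, v) \<in> canon m \<Longrightarrow> mcs w \<and> mcs v"
  by (simp add: canon_def)

lemma canon_sym: "(w, v) \<in> canon m \<Longrightarrow> (v, w) \<in> canon m"
  using canonI[of v w m] canon_Box_iff[of w v m] canon_mcs by blast

lemma canon_trans: "(w, u) \<in> canon m \<Longrightarrow> (u, v) \<in> canon m \<Longrightarrow> (w, v) \<in> canon m"
  using canonI[of w v m] canon_Box_iff[of w u m] canon_Box_iff[of u v m] canon_mcs by blast

text \<open>The formulas boxed in \<open>w\<close> do not derive \<open>\<phi>\<close>, since
  otherwise its box would be in \<open>w\<close>; Lindenbaum then supplies \<open>v\<close>.\<close>

lemma canon_exists: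
  assumes "mcs w" "Box m \<phi> \<notin> w" "\<phi> \<in> L"
  obtains v where "(w, v) \<in> canon m" "\<phi> \<notin> v"
proof -
  have "{\<psi>. Box m \<psi> \<in> w} \<subseteq> L" using mcs_language[OF assms(1)] by fastforce
  then obtain v where "mcs v" "{\<psi>. Box m \<psi> \<in> w} \<subseteq> v" "\<phi> \<notin> v"
    using Lindenbaum assms mcs_Box_derives by metis
  then show ?thesis using that assms by (auto simp: canon_def)
qed

section \<open>Commutation of the canonical relations\<close>

lemma WPLC_Box_mono:
  assumes "WPLC Atm0 Val (Imp \<phi> \<psi>)"
  shows "WPLC Atm0 Val (Imp (Box m \<phi>) (Box m \<psi>))"
proof -
  have L: "\<phi> \<in> L" "\<psi> \<in> L" using WPLC_language[OF assms] by auto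
  have "derives {} (Imp (Box m \<phi>) (Box m \<psi>))"
    by (rule derives_taut2[OF axm[OF Nec[OF assms, of m]] axm[OF K[of \<phi> _ _ \<psi> m]]])
      (use L in \<open>auto simp: tautology_def\<close>)
  then show ?thesis by (rule derives_empty)
qed

text \<open>All hypotheses taken from \<open>v\<close> are collected into a single
  \<open>\<psi>\<close>, and what remains is a derivation from the formulas that \<open>w\<close>
  boxes by \<open>F\<close>. The antecedent keeps its box so that axiom 5 and \<open>Comm\<close>
  apply to its negation later. The formula \<open>\<alpha>\<close> only provides a tautology to
  box.\<close>

lemma derives_canon_union:
  assumes w: "mcs w" and v: "mcs v" and "\<alpha> \<in> L"
  shows "derives ({\<phi>. Box F \<phi> \<in> w} \<union> {\<psi>. Box I \<psi> \<in> v}) \<phi> \<Longrightarrow>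
    \<exists>\<psi>. Box I \<psi> \<in> v \<and> Box F (Imp (Box I \<psi>) \<phi>) \<in> w"
proof (induction rule: derives.induct)
  let ?D = "derives {\<phi>. Box F \<phi> \<in> w}"
  have weaken: "\<exists>\<psi>. Box I \<psi> \<in> v \<and> Box F (Imp (Box I \<psi>) \<phi>) \<in> w" if "?D \<phi>" for \<phi>
  proof -
    \<comment> \<open>A boxed tautology serves as antecedent when nothing from \<open>v\<close> was
      used.\<close>
    let ?t = "Imp \<alpha> \<alpha>"
    have "WPLC Atm0 Val ?t" using assms by (intro Taut) (auto simp: tautology_def)
    then have "Box I ?t \<in> v" using v by (intro mcs_WPLC Nec)
    moreover have "?D (Imp (Box I ?t) \<phi>)"
      using that derives_language[OF that] assms
      by (rule_tac derives_taut1) (auto simp: tautology_def)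
    ultimately show ?thesis using mcs_Box_derives[OF w] by blast
  qed
  {
    case (hyp \<phi>)
    show ?case
    proof (cases "Box F \<phi> \<in> w")
      case True
      then show ?thesis using hyp by (intro weaken derives.hyp) auto
    next
      case False
      then have "Box I \<phi> \<in> v" using hyp by simp
      moreover have "Box F (Imp (Box I \<phi>) \<phi>) \<in> w"
        using mcs_WPLC[OF w Nec[OF T[OF hyp(2)]]] .
      ultimately show ?thesis by blast
    qed
  next
    case (axm \<phi>)
    then show ?case by (intro weaken derives.axm)
  next
    case (mp \<phi> \<chi>)
    then obtain \<psi> \<psi>' where
      \<psi>: "Box I \<psi> \<in> v" "Box F (Imp (Box I \<psi>) \<phi>) \<in> w" and
      \<psi>': "Box I \<psi>' \<in> v" "Box F (Imp (Box I \<psi>') (Imp \<phi> \<chi>)) \<in> w"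
      by blast
    \<comment> \<open>The boxed conjunction implies both boxed antecedents, so it can replace each
      of them.\<close>
    let ?\<theta> = "And \<psi> \<psi>'"
    have L: "\<psi> \<in> L" "\<psi>' \<in> L" "\<chi> \<in> L" "\<phi> \<in> L"
      using mcs_language[OF v \<psi>(1)] mcs_language[OF v \<psi>'(1)] derives_language[OF mp(2)] by auto
    have "derives {\<psi>. Box I \<psi> \<in> v} ?\<theta>"
      by (rule derives_taut2[OF hyp[of \<psi>] hyp[of \<psi>']])
        (use \<psi> \<psi>' L in \<open>auto simp: tautology_def\<close>)
    then have "Box I ?\<theta> \<in> v" by (rule mcs_Box_derives[OF v])
    moreover have "Box F (Imp (Box I ?\<theta>) \<chi>) \<in> w"
    proof (rule mcs_Box_derives[OF w])
      have "WPLC Atm0 Val (Imp (Box I ?\<theta>) (Box I \<psi>))" "WPLC Atm0 Val (Imp (Box I ?\<theta>) (Box I \<psi>'))"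
        using L by (auto intro!: WPLC_Box_mono Taut simp: tautology_def)
      then have d: "?D (Imp (Box I ?\<theta>) (Box I \<psi>))" "?D (Imp (Box I ?\<theta>) (Box I \<psi>'))"
        by (auto intro: derives.axm)
      have "?D (Imp (Box I ?\<theta>) \<phi>)"
        by (rule derives_taut2[OF d(1) hyp[of "Imp (Box I \<psi>) \<phi>"]])
          (use \<psi> L in \<open>auto simp: tautology_def\<close>)
      moreover have "?D (Imp (Box I ?\<theta>) (Imp \<phi> \<chi>))"
        by (rule derives_taut2[OF d(2) hyp[of "Imp (Box I \<psi>') (Imp \<phi> \<chi>)"]])
          (use \<psi>' L in \<open>auto simp: tautology_def\<close>)
      ultimately show "?D (Imp (Box I ?\<theta>) \<chi>)"
        by (rule derives_taut2) (use L in \<open>auto simp: tautology_def\<close>)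
    qed
    ultimately show ?case by blast
  }
qed

lemma canon_commute:
  assumes "\<alpha> \<in> L" "(w, u) \<in> canon I" "(u, v) \<in> canon F"
  shows "(w, v) \<in> canon F O canon I"
proof -
  let ?S = "{\<phi>. Box F \<phi> \<in> w} \<union> {\<psi>. Box I \<psi> \<in> v}"
  \<comment> \<open>This contradiction stands in for falsum.\<close>
  let ?f = "And \<alpha> (Neg \<alpha>)"
  have w: "mcs w" and v: "mcs v" using assms by (auto simp: canon_def)
  have "\<not> derives ?S ?f"
  proof
    assume "derives ?S ?f"
    then obtain \<psi> where \<psi>: "Box I \<psi> \<in> v" "Box F (Imp (Box I \<psi>) ?f) \<in> w"
      using derives_canon_union[OF w v assms(1)] by blast
    let ?n = "Neg (Box I \<psi>)"
    have L: "\<psi> \<in> L" using mcs_language[OF v \<psi>(1)] by simp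
    have "derives {\<phi>. Box F \<phi> \<in> w} ?n"
      by (rule derives_taut1[OF hyp[of "Imp (Box I \<psi>) ?f"]])
        (use \<psi> assms(1) L in \<open>auto simp: tautology_def\<close>)
    then have "derives {\<phi>. Box F \<phi> \<in> w} (Box I ?n)"
      using mp axm[OF Five] L by blast
    then have "Box F (Box I ?n) \<in> w" by (rule mcs_Box_derives[OF w])
    moreover have "Imp (Box F (Box I ?n)) (Box I (Box F ?n)) \<in> w"
      using mcs_WPLC[OF w Comm[of ?n]] L mcs_And[OF w] by simp
    ultimately have "Box I (Box F ?n) \<in> w"
      using w L by (simp add: mcs_Neg mcs_And)
    \<comment> \<open>The outer box is discharged along \<open>I\<close> from \<open>w\<close> to
      \<open>u\<close>, the inner one along \<open>F\<close> from \<open>u\<close> to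
      \<open>v\<close>.\<close>
    then have "?n \<in> v" using assms by (auto simp: canon_def)
    then show False using \<psi> v L by (simp add: mcs_Neg)
  qed
  moreover have "?S \<subseteq> L" using mcs_language[OF w] mcs_language[OF v] by fastforce
  ultimately obtain x where "mcs x" "?S \<subseteq> x"
    using Lindenbaum[of ?S ?f] assms(1) by (metis language_simps(1,2))
  then have "(w, x) \<in> canon F" "(v, x) \<in> canon I"
    using w v by (auto simp: canon_def)
  then show ?thesis using canon_sym by blast
qed

section \<open>Truth lemma and completeness\<close>

definition canon_model :: "(('p, 'v) atom fm set, 'p, 'v) model" where
  "canon_model = \<lparr>worlds = {w. mcs w}, rel = canon, val = \<lambda>w. {q. Atom q \<in> w}\<rparr>"

text \<open>The boxed case rests on \<open>canon_exists\<close>: if a box is missing from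
  \<open>w\<close>, some related set omits its body.\<close>

lemma truth_lemma:
  "mcs w \<Longrightarrow> \<phi> \<in> L \<Longrightarrow> sat canon_model w \<phi> \<longleftrightarrow> \<phi> \<in> w"
proof (induction \<phi> arbitrary: w)
  case (Box m \<phi>)
  have "sat canon_model w (Box m \<phi>) \<longleftrightarrow>
      (\<forall>v. mcs v \<longrightarrow> (w, v) \<in> canon m \<longrightarrow> sat canon_model v \<phi>)"
    by (simp add: canon_model_def)
  also have "\<dots> \<longleftrightarrow> (\<forall>v. (w, v) \<in> canon m \<longrightarrow> \<phi> \<in> v)"
    using Box.IH Box.prems(2) unfolding canon_def by auto
  also have "\<dots> \<longleftrightarrow> Box m \<phi> \<in> w"
  proof
    assume "\<forall>v. (w, v) \<in> canon m \<longrightarrow> \<phi> \<in> v"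
    then show "Box m \<phi> \<in> w"
      using canon_exists[OF Box.prems(1)] Box.prems(2) by (metis language_simps(3))
  qed (simp add: canon_def)
  finally show ?case .
qed (auto simp: canon_model_def mcs_Neg mcs_And)

lemma canon_model_quasi_MDM:
  assumes "finite Val" "\<alpha> \<in> L"
  shows "quasi_MDM Atm0 Val canon_model"
proof -
  have equiv: "equiv {w. mcs w} (canon m)" for m
    by (auto simp: equiv_def refl_on_def intro!: symI transI canon_refl
        intro: canon_sym canon_trans, auto simp: canon_def)
  have sub: "q \<in> Atm Atm0 Val" if "mcs w" "Atom q \<in> w" for w q
    using mcs_language[OF that] by simp
  have comm: "canon I O canon F = canon F O canon I"
  proof
    show *: "canon I O canon F \<subseteq> canon F O canon I"
      using canon_commute[OF assms(2)] by blast
    \<comment> \<open>Taking converses exchanges the two compositions, as both relations are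
      symmetric; the reverse inclusion is thus the first one read backwards.\<close>
    show "canon F O canon I \<subseteq> canon I O canon F"
    proof clarify
      fix w u v assume "(w, u) \<in> canon F" "(u, v) \<in> canon I"
      then have "(v, w) \<in> canon F O canon I"
        using * canon_sym by blast
      then show "(w, v) \<in> canon I O canon F"
        using canon_sym by blast
    qed
  qed
  \<comment> \<open>One inclusion suffices, since \<open>canon_sym\<close> provides the
    other.\<close>
  have C3: "{q. Atom q \<in> w} \<inter> Prp ` Atm0 \<subseteq> {q. Atom q \<in> v} \<inter> Prp ` Atm0"
    if "(w, v) \<in> canon F" for w v
    using that mcs_Imp[OF _ Indep_pos] unfolding canon_def by blast
  have C4: "Atom (Dec y) \<notin> w"
    if "mcs w" "x \<in> Val" "y \<in> Val" "Atom (Dec x) \<in> w" "x \<noteq> y" for w x y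
    using mcs_Imp[OF that(1) AtMost[OF that(2,3,5)] that(4)] mcs_Neg that by simp
  have C5: "\<exists>x \<in> Val. Atom (Dec x) \<in> w" if w: "mcs w" for w
  proof -
    obtain xs where xs: "distinct xs" "set xs = Val"
      using finite_distinct_list assms(1) by metis
    \<comment> \<open>The default value of the disjunction is excluded, so a genuine disjunct is in
      \<open>w\<close>. For empty \<open>Val\<close> this shows that there are no canonical worlds
      at all.\<close>
    have "And \<alpha> (Neg \<alpha>) \<notin> w" using w assms by (simp add: mcs_And mcs_Neg)
    then show ?thesis
      using mcs_Disj[OF w mcs_WPLC[OF w AtLeast[OF xs assms(2)]]] xs(2) by auto
  qed
  show ?thesis
    unfolding quasi_MDM_def canon_model_def model.simps mem_Collect_eq
  proof (intro conjI)
    show "\<forall>m. equiv {w. mcs w} (canon m)" using equiv by blast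
    show "\<forall>w\<in>{w. mcs w}. {q. Atom q \<in> w} \<subseteq> Atm Atm0 Val" using sub by blast
    show "canon I O canon F = canon F O canon I" by (rule comm)
    show "\<forall>w\<in>{w. mcs w}. \<forall>v\<in>{w. mcs w}. (w, v) \<in> canon F \<longrightarrow>
        {q. Atom q \<in> w} \<inter> Prp ` Atm0 = {q. Atom q \<in> v} \<inter> Prp ` Atm0"
      by (intro ballI impI subset_antisym; rule C3; (assumption | erule canon_sym))
    show "\<forall>w\<in>{w. mcs w}. \<forall>x\<in>Val. \<forall>y\<in>Val. Atom (Dec x) \<in> w \<and> x \<noteq> y \<longrightarrow> Atom (Dec y) \<notin> w"
      using C4 by blast
    show "\<forall>w\<in>{w. mcs w}. \<exists>x\<in>Val. Atom (Dec x) \<in> w"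
      using C5 by blast
  qed
qed

lemma WPLC_complete:
  assumes "finite Val" "\<phi> \<in> L"
    and valid: "QMDM_valid TYPE(('p, 'v) atom fm set) Atm0 Val \<phi>"
  shows "WPLC Atm0 Val \<phi>"
proof (rule ccontr)
  assume "\<not> WPLC Atm0 Val \<phi>"
  then obtain w where w: "mcs w" "\<phi> \<notin> w"
    using Lindenbaum[of "{}" \<phi>] derives_empty assms(2) by blast
  \<comment> \<open>Here \<open>\<phi>\<close> itself plays the part of \<open>\<alpha>\<close>, the
    formula showing that the language is nonempty.\<close>
  then have "sat canon_model w \<phi>"
    using valid canon_model_quasi_MDM[OF assms(1,2)]
    by (auto simp: QMDM_valid_def canon_model_def)
  then show False using truth_lemma w assms(2) by simp
qed

end

theorem theorem5:
  fixes Atm0 :: "'p set" and Val :: "'v set" and \<phi> :: "('p, 'v) atom fm"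
  assumes "countable Atm0" and "finite Val" and "\<phi> \<in> language Atm0 Val"
  shows "(WPLC Atm0 Val \<phi> \<longrightarrow> QMDM_valid TYPE('w) Atm0 Val \<phi>) \<and>
    (WPLC Atm0 Val \<phi> \<longleftrightarrow> QMDM_valid TYPE(('p, 'v) atom fm set) Atm0 Val \<phi>)"
  using WPLC_complete[OF assms(2,3)] by (auto intro: WPLC_valid)

end
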